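(* Assume that $(H_1)$, $(H_1^{\mathcal B})$ and $(H_2^{\mathcal B})$ (as stated in the context) hold, with activation functions $g_i$ of class $\mathcal B$. Then for each $\Sigma=(\varsigma_1,\dots,\varsigma_N)\in\{1,2\}^N$ there exists at least one almost periodic solution $\hat u=(\hat u^1,\dots,\hat u^N):\mathbb R\to\mathbb R^N$ of (GNN) such that $\alpha_{i\varsigma_i}\le\hat u^i(t)\le\beta_{i\varsigma_i}$ for all $t\in\mathbb R$ and all $i=1,\dots,N$.
   Context: **System.** Let $N,M\ge1$ be integers; indices satisfy $i,j\in\{1,\dots,N\}$, $l\in\{1,\dots,M\}$. The general neural network (GNN) is $$\frac{du^i(t)}{dt}=-c_i(t)u^i(t)+\sum_{l=1}^M\sum_{j=1}^N a_{ijl}(t)\,g_j\big(\sigma_j u^j(t-\kappa_{ijl}(t))\big)+J_i(t),\qquad i=1,\dots,N. \tag{GNN}$$ The delays satisfy $0<\kappa_{ijl}(t)\le\kappa_{ijl}$ with constants $\kappa_{ijl}$, and $\kappa:=\max_{i,j,l}\kappa_{ijl}$. **Almost periodic** is in the sense of Bohr: a continuous $f:\mathbb R\to\mathbb R$ such that for each $\epsilon>0$ the set $\{T:|f(t+T)-f(t)|<\epsilon\ \forall t\in\mathbb R\}$ is relatively dense. A vector function is almost periodic if each component is. **$(H_1)$**: $c_i(t)>0$, $a_{ijl}(t)$, $\kappa_{ijl}(t)>0$, $J_i(t)$ are almost periodic functions on $\mathbb R$; $\sigma_j>0$ are constants; $a_{iil}(t)>0$. Moreover $\inf_tc_i(t)>0$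 (needed for the definitions of $\alpha_{i1},\beta_{i2}$ below). All $\sup$ and $\inf$ over $t$ are over $t\in\mathbb R$. **Class $\mathcal B$**: $g_j:\mathbb R\to\mathbb R$ is continuous with $g_j(x)=u_{j1}$ for $x<\ell_{j1}$, $g_j(x)=\tilde g_j(x)$ for $\ell_{j1}\le x\le\ell_{j2}$, $g_j(x)=u_{j2}$ for $x>\ell_{j2}$, where $\tilde g_j$ is a $C^1$ increasing function with $\tilde g_j(0)=0$, and $\ell_{j1}<0<\ell_{j2}$, $-\infty<u_{j1}<0<u_{j2}<+\infty$ are constants. Write $U_j:=\max\{|u_{j1}|,|u_{j2}|\}$. **Auxiliary functions**: $F_i(z)=-\big(\sup_{t}c_i(t)\big)z+\big(\inf_{t}\sum_{l=1}^M a_{iil}(t)\big)g_i(\sigma_i z)$. **$(H_1^{\mathcal B})$**: for every $i$ and every $\zeta\in[\ell_{i1},\ell_{i2}]$, $\ \sup_tc_i(t)<\big(\inf_t\sum_{l=1}^Ma_{iil}(t)\big)\sigma_i\dot{\tilde g}_i(\zeta)$. **$(H_2^{\mathcal B})$**: for every $i$, $k=1,2$ and all $t\in\mathbb R$, $$(-1)^k\Big\{-\sup_tc_i(t)\frac{\ell_{ik}}{\sigma_i}+\Big(\inf_t\sum_{l=1}^Ma_{iil}(t)\Big)u_{ik}+J_i(t)\Big\}>\sum_{l=1}^M\sum_{j\ne i}\sup_t|a_{ijl}(t)|\,U_j .$$ **Bounds**: $\beta_{i1}:=\hat\ell_{i1}$ is the point $\hat\ell_{i1}<\ell_{i1}/\sigma_i$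 with $F_i(\hat\ell_{i1})+\sum_l\sum_{j\ne i}\sup_t|a_{ijl}(t)|U_j+\sup_tJ_i(t)=0$; $\alpha_{i2}:=\tilde\ell_{i2}$ is the point $\tilde\ell_{i2}>\ell_{i2}/\sigma_i$ with $F_i(\tilde\ell_{i2})-\sum_l\sum_{j\ne i}\sup_t|a_{ijl}(t)|U_j+\inf_tJ_i(t)=0$; and $$\beta_{i2}:=\frac{\sum_{l=1}^M\sum_{j=1}^N\sup_t|a_{ijl}(t)|U_j+\sup_t|J_i(t)|}{\inf_tc_i(t)},\qquad\alpha_{i1}:=-\beta_{i2}.$$ One has $\alpha_{i1}<\beta_{i1}<0<\alpha_{i2}<\beta_{i2}$. *)

theory Defs
  imports "HOL-Analysis.Analysis"
begin

text \<open>
  Neurons are indexed by a finite type \<open>'n\<close> and the delayed terms by a finite type \<open>'m\<close>.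
  The subscript \<open>k \<in> {1, 2}\<close> of the thresholds \<open>ell i k\<close>, of the saturation levels \<open>v i k\<close>
  (written \<open>u\<close> with subscripts \<open>i k\<close> in the literature) and of the bounds below
  is a natural number.
\<close>

definition relatively_dense :: "real set \<Rightarrow> bool" where
  "relatively_dense S \<longleftrightarrow> (\<exists>L>0. \<forall>x. S \<inter> {x..x + L} \<noteq> {})"

definition almost_periodic :: "(real \<Rightarrow> real) \<Rightarrow> bool" where
  "almost_periodic f \<longleftrightarrow> continuous_on UNIV f \<and>
     (\<forall>\<epsilon>>0. relatively_dense {T. \<forall>t. \<bar>f (t + T) - f t\<bar> < \<epsilon>})"

definition almost_periodic_vec :: "(real \<Rightarrow> real ^ 'n) \<Rightarrow> bool" where
  "almost_periodic_vec u \<longleftrightarrow> (\<forall>i. almost_periodic (\<lambda>t. u t $ i))"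

definition gnn_solution ::
  "('n::finite \<Rightarrow> real \<Rightarrow> real) \<Rightarrow> ('n \<Rightarrow> 'n \<Rightarrow> 'm::finite \<Rightarrow> real \<Rightarrow> real) \<Rightarrow>
   ('n \<Rightarrow> 'n \<Rightarrow> 'm \<Rightarrow> real \<Rightarrow> real) \<Rightarrow> ('n \<Rightarrow> real \<Rightarrow> real) \<Rightarrow> ('n \<Rightarrow> real) \<Rightarrow>
   ('n \<Rightarrow> real \<Rightarrow> real) \<Rightarrow> (real \<Rightarrow> real ^ 'n) \<Rightarrow> bool" where
  "gnn_solution c a \<kappa> J \<sigma> g u \<longleftrightarrow>
     (\<forall>i t. ((\<lambda>s. u s $ i) has_real_derivative
        - c i t * u t $ i
        + (\<Sum>l\<in>UNIV. \<Sum>j\<in>UNIV. a i j l t * g j (\<sigma> j * u (t - \<kappa> i j l t) $ j))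
        + J i t) (at t))"

definition H1 ::
  "('n::finite \<Rightarrow> real \<Rightarrow> real) \<Rightarrow> ('n \<Rightarrow> 'n \<Rightarrow> 'm::finite \<Rightarrow> real \<Rightarrow> real) \<Rightarrow>
   ('n \<Rightarrow> 'n \<Rightarrow> 'm \<Rightarrow> real \<Rightarrow> real) \<Rightarrow> ('n \<Rightarrow> real \<Rightarrow> real) \<Rightarrow> ('n \<Rightarrow> real) \<Rightarrow> bool" where
  "H1 c a \<kappa> J \<sigma> \<longleftrightarrow>
     (\<forall>i. almost_periodic (c i) \<and> (\<forall>t. c i t > 0) \<and> (INF t. c i t) > 0) \<and>
     (\<forall>i j l. almost_periodic (a i j l)) \<and>
     (\<forall>i l t. a i i l t > 0) \<and>
     (\<forall>i j l. almost_periodic (\<kappa> i j l) \<and> (\<forall>t. \<kappa> i j l t > 0)) \<and>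
     (\<forall>i. almost_periodic (J i)) \<and>
     (\<forall>j. \<sigma> j > 0)"

text \<open>
  Only the values of \<open>gt\<close> on \<open>[ell 1, ell 2]\<close> matter, so it is required to be of class \<open>C\<^sup>1\<close> on that
  interval, with one-sided derivatives at the end points.
\<close>

definition class_B ::
  "(real \<Rightarrow> real) \<Rightarrow> (real \<Rightarrow> real) \<Rightarrow> (nat \<Rightarrow> real) \<Rightarrow> (nat \<Rightarrow> real) \<Rightarrow> bool" where
  "class_B g gt ell v \<longleftrightarrow>
     ell 1 < 0 \<and> 0 < ell 2 \<and> v 1 < 0 \<and> 0 < v 2 \<and>
     continuous_on UNIV g \<and>
     (\<forall>x<ell 1. g x = v 1) \<and>
     (\<forall>x\<in>{ell 1..ell 2}. g x = gt x) \<and>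
     (\<forall>x>ell 2. g x = v 2) \<and>
     (\<forall>x\<in>{ell 1..ell 2}. gt differentiable (at x within {ell 1..ell 2})) \<and>
     continuous_on {ell 1..ell 2} (\<lambda>x. vector_derivative gt (at x within {ell 1..ell 2})) \<and>
     mono_on {ell 1..ell 2} gt \<and>
     gt 0 = 0"

definition U :: "('n \<Rightarrow> nat \<Rightarrow> real) \<Rightarrow> 'n \<Rightarrow> real" where
  "U v j = max \<bar>v j 1\<bar> \<bar>v j 2\<bar>"

definition H1B ::
  "('n::finite \<Rightarrow> real \<Rightarrow> real) \<Rightarrow> ('n \<Rightarrow> 'n \<Rightarrow> 'm::finite \<Rightarrow> real \<Rightarrow> real) \<Rightarrow> ('n \<Rightarrow> real) \<Rightarrow>
   ('n \<Rightarrow> real \<Rightarrow> real) \<Rightarrow> ('n \<Rightarrow> nat \<Rightarrow> real) \<Rightarrow> bool" where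
  "H1B c a \<sigma> gt ell \<longleftrightarrow>
     (\<forall>i. \<forall>\<zeta>\<in>{ell i 1..ell i 2}.
        (SUP t. c i t) < (INF t. \<Sum>l\<in>UNIV. a i i l t) * \<sigma> i *
          vector_derivative (gt i) (at \<zeta> within {ell i 1..ell i 2}))"

definition coupling ::
  "('n::finite \<Rightarrow> 'n \<Rightarrow> 'm::finite \<Rightarrow> real \<Rightarrow> real) \<Rightarrow> ('n \<Rightarrow> nat \<Rightarrow> real) \<Rightarrow> 'n \<Rightarrow> real" where
  "coupling a v i = (\<Sum>l\<in>UNIV. \<Sum>j\<in>UNIV - {i}. (SUP t. \<bar>a i j l t\<bar>) * U v j)"

definition H2B ::
  "('n::finite \<Rightarrow> real \<Rightarrow> real) \<Rightarrow> ('n \<Rightarrow> 'n \<Rightarrow> 'm::finite \<Rightarrow> real \<Rightarrow> real) \<Rightarrow>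
   ('n \<Rightarrow> real \<Rightarrow> real) \<Rightarrow> ('n \<Rightarrow> real) \<Rightarrow> ('n \<Rightarrow> nat \<Rightarrow> real) \<Rightarrow> ('n \<Rightarrow> nat \<Rightarrow> real) \<Rightarrow> bool" where
  "H2B c a J \<sigma> ell v \<longleftrightarrow>
     (\<forall>i. \<forall>k\<in>{1, 2}. \<forall>t.
        (-1) ^ k * (- (SUP s. c i s) * (ell i k / \<sigma> i)
                    + (INF s. \<Sum>l\<in>UNIV. a i i l s) * v i k + J i t) > coupling a v i)"

definition F ::
  "('n::finite \<Rightarrow> real \<Rightarrow> real) \<Rightarrow> ('n \<Rightarrow> 'n \<Rightarrow> 'm::finite \<Rightarrow> real \<Rightarrow> real) \<Rightarrow> ('n \<Rightarrow> real) \<Rightarrow>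
   ('n \<Rightarrow> real \<Rightarrow> real) \<Rightarrow> 'n \<Rightarrow> real \<Rightarrow> real" where
  "F c a \<sigma> g i z = - (SUP t. c i t) * z + (INF t. \<Sum>l\<in>UNIV. a i i l t) * g i (\<sigma> i * z)"

text \<open>
  \<open>H2B\<close> bounds \<open>J i t\<close> strictly for every single \<open>t\<close>, but \<open>sup J\<close> and \<open>inf J\<close> need not be attained.
  In the borderline case the roots below are the points \<open>ell i 1 / \<sigma> i\<close> and \<open>ell i 2 / \<sigma> i\<close>
  themselves, and there is none strictly beyond them; hence the non-strict inequalities, which
  make the roots exist in all cases. Any root satisfying the strict inequality is the one chosen
  (lemmas \<open>ell_hat_eq\<close> and \<open>ell_tilde_eq\<close>).
\<close>

definition ell_hat ::
  "('n::finite \<Rightarrow> real \<Rightarrow> real) \<Rightarrow> ('n \<Rightarrow> 'n \<Rightarrow> 'm::finite \<Rightarrow> real \<Rightarrow> real) \<Rightarrow>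
   ('n \<Rightarrow> real \<Rightarrow> real) \<Rightarrow> ('n \<Rightarrow> real) \<Rightarrow> ('n \<Rightarrow> real \<Rightarrow> real) \<Rightarrow>
   ('n \<Rightarrow> nat \<Rightarrow> real) \<Rightarrow> ('n \<Rightarrow> nat \<Rightarrow> real) \<Rightarrow> 'n \<Rightarrow> real" where
  "ell_hat c a J \<sigma> g ell v i =
     (THE z. z \<le> ell i 1 / \<sigma> i \<and> F c a \<sigma> g i z + coupling a v i + (SUP t. J i t) = 0)"

definition ell_tilde ::
  "('n::finite \<Rightarrow> real \<Rightarrow> real) \<Rightarrow> ('n \<Rightarrow> 'n \<Rightarrow> 'm::finite \<Rightarrow> real \<Rightarrow> real) \<Rightarrow>
   ('n \<Rightarrow> real \<Rightarrow> real) \<Rightarrow> ('n \<Rightarrow> real) \<Rightarrow> ('n \<Rightarrow> real \<Rightarrow> real) \<Rightarrow>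
   ('n \<Rightarrow> nat \<Rightarrow> real) \<Rightarrow> ('n \<Rightarrow> nat \<Rightarrow> real) \<Rightarrow> 'n \<Rightarrow> real" where
  "ell_tilde c a J \<sigma> g ell v i =
     (THE z. z \<ge> ell i 2 / \<sigma> i \<and> F c a \<sigma> g i z - coupling a v i + (INF t. J i t) = 0)"

definition outer_bound ::
  "('n::finite \<Rightarrow> real \<Rightarrow> real) \<Rightarrow> ('n \<Rightarrow> 'n \<Rightarrow> 'm::finite \<Rightarrow> real \<Rightarrow> real) \<Rightarrow>
   ('n \<Rightarrow> real \<Rightarrow> real) \<Rightarrow> ('n \<Rightarrow> nat \<Rightarrow> real) \<Rightarrow> 'n \<Rightarrow> real" where
  "outer_bound c a J v i =
     ((\<Sum>l\<in>UNIV. \<Sum>j\<in>UNIV. (SUP t. \<bar>a i j l t\<bar>) * U v j) + (SUP t. \<bar>J i t\<bar>)) / (INF t. c i t)"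

definition \<alpha> ::
  "('n::finite \<Rightarrow> real \<Rightarrow> real) \<Rightarrow> ('n \<Rightarrow> 'n \<Rightarrow> 'm::finite \<Rightarrow> real \<Rightarrow> real) \<Rightarrow>
   ('n \<Rightarrow> real \<Rightarrow> real) \<Rightarrow> ('n \<Rightarrow> real) \<Rightarrow> ('n \<Rightarrow> real \<Rightarrow> real) \<Rightarrow>
   ('n \<Rightarrow> nat \<Rightarrow> real) \<Rightarrow> ('n \<Rightarrow> nat \<Rightarrow> real) \<Rightarrow> 'n \<Rightarrow> nat \<Rightarrow> real" where
  "\<alpha> c a J \<sigma> g ell v i k =
     (if k = 1 then - outer_bound c a J v i else ell_tilde c a J \<sigma> g ell v i)"

definition \<beta> ::
  "('n::finite \<Rightarrow> real \<Rightarrow> real) \<Rightarrow> ('n \<Rightarrow> 'n \<Rightarrow> 'm::finite \<Rightarrow> real \<Rightarrow> real) \<Rightarrow>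
   ('n \<Rightarrow> real \<Rightarrow> real) \<Rightarrow> ('n \<Rightarrow> real) \<Rightarrow> ('n \<Rightarrow> real \<Rightarrow> real) \<Rightarrow>
   ('n \<Rightarrow> nat \<Rightarrow> real) \<Rightarrow> ('n \<Rightarrow> nat \<Rightarrow> real) \<Rightarrow> 'n \<Rightarrow> nat \<Rightarrow> real" where
  "\<beta> c a J \<sigma> g ell v i k =
     (if k = 1 then ell_hat c a J \<sigma> g ell v i else outer_bound c a J v i)"

lemma class_B_left:
  assumes "class_B g gt ell v" "x \<le> ell 1"
  shows "g x = v 1"
proof (cases "x = ell 1")
  case True
  have "isCont g x"
    using assms(1) by (simp add: class_B_def continuous_on_eq_continuous_at)
  then have "(g \<longlongrightarrow> g x) (at_left x)"
    by (simp add: isCont_def filterlim_at_split)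
  moreover have "eventually (\<lambda>y. g y = v 1) (at_left x)"
    using assms(1) True by (auto simp: class_B_def eventually_at_filter)
  ultimately have "((\<lambda>_. v 1) \<longlongrightarrow> g x) (at_left x)"
    using tendsto_cong by fastforce
  then show ?thesis
    by (simp add: tendsto_const_iff)
qed (use assms in \<open>auto simp: class_B_def\<close>)

lemma class_B_right:
  assumes "class_B g gt ell v" "x \<ge> ell 2"
  shows "g x = v 2"
proof (cases "x = ell 2")
  case True
  have "isCont g x"
    using assms(1) by (simp add: class_B_def continuous_on_eq_continuous_at)
  then have "(g \<longlongrightarrow> g x) (at_right x)"
    by (simp add: isCont_def filterlim_at_split)
  moreover have "eventually (\<lambda>y. g y = v 2) (at_right x)"
    using assms(1) True by (auto simp: class_B_def eventually_at_filter)
  ultimately have "((\<lambda>_. v 2) \<longlongrightarrow> g x) (at_right x)"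
    using tendsto_cong by fastforce
  then show ?thesis
    by (simp add: tendsto_const_iff)
qed (use assms in \<open>auto simp: class_B_def\<close>)

lemma ell_hat_eq:
  assumes "class_B (g i) gt (ell i) (v i)" "\<sigma> i > 0" "(SUP t. c i t) > 0"
    and "z < ell i 1 / \<sigma> i" "F c a \<sigma> g i z + coupling a v i + (SUP t. J i t) = 0"
  shows "ell_hat c a J \<sigma> g ell v i = z"
proof -
  have F: "F c a \<sigma> g i y = - (SUP t. c i t) * y + (INF t. \<Sum>l\<in>UNIV. a i i l t) * v i 1"
    if "y \<le> ell i 1 / \<sigma> i" for y
    using class_B_left[OF assms(1), of "\<sigma> i * y"] that assms(2)
    by (simp add: F_def field_simps)
  show ?thesis
    unfolding ell_hat_def
  proof (rule the_equality)
    fix y assume y: "y \<le> ell i 1 / \<sigma> i \<and> F c a \<sigma> g i y + coupling a v i + (SUP t. J i t) = 0"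
    then have "(SUP t. c i t) * y = (SUP t. c i t) * z"
      using F[of y] F[of z] assms(4,5) by linarith
    then show "y = z" using assms(3) by simp
  qed (use assms in auto)
qed

lemma ell_tilde_eq:
  assumes "class_B (g i) gt (ell i) (v i)" "\<sigma> i > 0" "(SUP t. c i t) > 0"
    and "z > ell i 2 / \<sigma> i" "F c a \<sigma> g i z - coupling a v i + (INF t. J i t) = 0"
  shows "ell_tilde c a J \<sigma> g ell v i = z"
proof -
  have F: "F c a \<sigma> g i y = - (SUP t. c i t) * y + (INF t. \<Sum>l\<in>UNIV. a i i l t) * v i 2"
    if "y \<ge> ell i 2 / \<sigma> i" for y
    using class_B_right[OF assms(1), of "\<sigma> i * y"] that assms(2)
    by (simp add: F_def field_simps)
  show ?thesis
    unfolding ell_tilde_def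
  proof (rule the_equality)
    fix y assume y: "y \<ge> ell i 2 / \<sigma> i \<and> F c a \<sigma> g i y - coupling a v i + (INF t. J i t) = 0"
    then have "(SUP t. c i t) * y = (SUP t. c i t) * z"
      using F[of y] F[of z] assms(4,5) by linarith
    then show "y = z" using assms(3) by simp
  qed (use assms in auto)
qed

end

theory Submission
  imports Defs
begin

text \<open>
  Beyond its thresholds each activation function is constant. Hence, as long as the component \<open>j\<close>
  stays beyond the threshold selected by \<open>\<Sigma> j\<close>, the delays disappear and the network decouples
  into scalar linear equations \<open>u' = - c u + b\<close> with almost periodic \<open>c\<close>, \<open>b\<close> and \<open>inf c > 0\<close>.
  Such an equation has a bounded solution, and comparison with constants bounds it by any \<open>K\<close> with
  \<open>b \<le> K c\<close>. Applied to the solution itself, this gives the required bounds, which place it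
  beyond the thresholds; applied to \<open>u (t + T) - u t\<close> for a common almost period \<open>T\<close> of \<open>c\<close> and
  \<open>b\<close>, it gives almost periodicity.
\<close>

section \<open>Almost periodic functions\<close>

text \<open>An almost period taken from \<open>{-s..-s + L}\<close> moves \<open>s\<close> into the
  fixed compact interval \<open>{0..L}\<close> and changes \<open>f\<close> by less than
  \<open>\<epsilon>\<close>. This reduces claims on the whole line to a compact interval; the choice
  function \<open>\<tau>\<close> keeps the shift tied to \<open>s\<close>.\<close>

lemma almost_periodic_near_period:
  assumes "almost_periodic f" "\<epsilon> > 0"
  obtains L \<tau> where "L > 0" "\<And>s. 0 \<le> s + \<tau> s" "\<And>s. s + \<tau> s \<le> L"
    "\<And>s t. \<bar>f (t + \<tau> s) - f t\<bar> < \<epsilon>"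
proof -
  obtain L where L: "L > 0" "\<And>x. {T. \<forall>t. \<bar>f (t + T) - f t\<bar> < \<epsilon>} \<inter> {x..x + L} \<noteq> {}"
    using assms unfolding almost_periodic_def relatively_dense_def by blast
  have "\<exists>T. 0 \<le> s + T \<and> s + T \<le> L \<and> (\<forall>t. \<bar>f (t + T) - f t\<bar> < \<epsilon>)" for s
  proof -
    have "{T. \<forall>t. \<bar>f (t + T) - f t\<bar> < \<epsilon>} \<inter> {-s..-s + L} \<noteq> {}" by (rule L(2))
    then obtain T where "\<forall>t. \<bar>f (t + T) - f t\<bar> < \<epsilon>" "-s \<le> T" "T \<le> -s + L" by auto
    then show ?thesis by (intro exI[of _ T] conjI) simp_all
  qed
  then have "\<exists>\<tau>. \<forall>s. 0 \<le> s + \<tau> s \<and> s + \<tau> s \<le> L \<and> (\<forall>t. \<bar>f (t + \<tau> s) - f t\<bar> < \<epsilon>)"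
    by (intro choice allI)
  with L(1) show thesis using that by blast
qed

text \<open>Heine-Cantor on a compact interval, carried to the whole line by almost periods. Both
  points are shifted by the almost period of \<open>x\<close>, so the interval has a margin of 1 to
  hold the image of \<open>y\<close>.\<close>

lemma almost_periodic_uniformly_continuous:
  assumes "almost_periodic f" "\<epsilon> > 0"
  obtains \<delta> where "\<delta> > 0" "\<And>x y. \<bar>x - y\<bar> < \<delta> \<Longrightarrow> \<bar>f x - f y\<bar> < \<epsilon>"
proof -
  obtain L \<tau> where L: "L > 0" "\<And>s. 0 \<le> s + \<tau> s" "\<And>s. s + \<tau> s \<le> L"
    "\<And>s t. \<bar>f (t + \<tau> s) - f t\<bar> < \<epsilon> / 3"
    using almost_periodic_near_period[OF assms(1), of "\<epsilon> / 3"] assms(2) by auto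
  have "continuous_on {-1..L+1} f"
    using assms(1) continuous_on_subset unfolding almost_periodic_def by blast
  then have "uniformly_continuous_on {-1..L+1} f"
    by (intro compact_uniformly_continuous) auto
  then obtain \<delta> where \<delta>: "\<delta> > 0"
    "\<And>x y. x \<in> {-1..L+1} \<Longrightarrow> y \<in> {-1..L+1} \<Longrightarrow> \<bar>x - y\<bar> < \<delta> \<Longrightarrow> \<bar>f x - f y\<bar> < \<epsilon> / 3"
    unfolding uniformly_continuous_on_def dist_real_def
    using assms(2) by (metis divide_pos_pos zero_less_numeral)
  show thesis
  proof (rule that[of "min \<delta> 1"])
    fix x y :: real assume xy: "\<bar>x - y\<bar> < min \<delta> 1"
    have "x + \<tau> x \<in> {-1..L+1}" "y + \<tau> x \<in> {-1..L+1}"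
      using L(2)[of x] L(3)[of x] xy by auto
    then have "\<bar>f (x + \<tau> x) - f (y + \<tau> x)\<bar> < \<epsilon> / 3"
      using \<delta>(2)[of "x + \<tau> x" "y + \<tau> x"] xy by auto
    with L(4)[of x x] L(4)[of y x] show "\<bar>f x - f y\<bar> < \<epsilon>" by linarith
  qed (use \<delta> in auto)
qed

text \<open>
  Bohr's condition in the form of total boundedness of the set of translates; unlike relative
  density of almost periods, this passes to pairs of functions by taking pairs of codes.
\<close>

lemma almost_periodic_finite_code:
  assumes "almost_periodic f" "\<epsilon> > 0"
  obtains h :: "real \<Rightarrow> int" where "finite (range h)"
    "\<And>s s' t. h s = h s' \<Longrightarrow> \<bar>f (t + s) - f (t + s')\<bar> < \<epsilon>"
proof -
  obtain L \<tau> where L: "L > 0" "\<And>s. 0 \<le> s + \<tau> s" "\<And>s. s + \<tau> s \<le> L"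
    "\<And>s t. \<bar>f (t + \<tau> s) - f t\<bar> < \<epsilon> / 3"
    using almost_periodic_near_period[OF assms(1), of "\<epsilon> / 3"] assms(2) by auto
  obtain \<delta> where \<delta>: "\<delta> > 0" "\<And>x y. \<bar>x - y\<bar> < \<delta> \<Longrightarrow> \<bar>f x - f y\<bar> < \<epsilon> / 3"
    using almost_periodic_uniformly_continuous[OF assms(1), of "\<epsilon> / 3"] assms(2) by auto
  \<comment> \<open>The code of \<open>s\<close> is the cell of length \<open>\<delta>\<close> that
    contains the shifted point \<open>s + \<tau> s\<close>. Only finitely many cells meet
    \<open>{0..L}\<close>, and translates with the same code differ by the two almost-period errors
    and one uniform-continuity error.\<close>
  define h where "h s = \<lfloor>(s + \<tau> s) / \<delta>\<rfloor>" for s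
  show thesis
  proof (rule that[of h])
    have "h s \<in> {0..\<lfloor>L / \<delta>\<rfloor>}" for s
      using L(2,3)[of s] \<delta>(1) by (auto simp: h_def intro!: floor_mono divide_right_mono)
    then show "finite (range h)"
      by (intro finite_subset[OF _ finite_atLeastAtMost_int]) blast
  next
    fix s s' t :: real assume "h s = h s'"
    then have "\<bar>(s + \<tau> s) / \<delta> - (s' + \<tau> s') / \<delta>\<bar> < 1"
      unfolding h_def by linarith
    then have "\<bar>(s + \<tau> s) - (s' + \<tau> s')\<bar> < \<delta>"
      using \<delta>(1) by (simp flip: diff_divide_distrib add: abs_divide)
    then have "\<bar>f (t + s + \<tau> s) - f (t + s' + \<tau> s')\<bar> < \<epsilon> / 3"
      by (intro \<delta>(2)) auto
    with L(4)[of "t + s" s] L(4)[of "t + s'" s'] show "\<bar>f (t + s) - f (t + s')\<bar> < \<epsilon>"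
      by linarith
  qed
qed

text \<open>Each value \<open>f t\<close> is within 1 of \<open>f\<close> at a representative of the
  code of \<open>t\<close>, and there are finitely many representatives.\<close>

lemma almost_periodic_bounded:
  assumes "almost_periodic f"
  obtains B where "\<And>t. \<bar>f t\<bar> \<le> B"
proof -
  obtain h :: "real \<Rightarrow> int" where h: "finite (range h)"
    "\<And>s s' t. h s = h s' \<Longrightarrow> \<bar>f (t + s) - f (t + s')\<bar> < 1"
    using almost_periodic_finite_code[OF assms, of 1] by auto
  define r where "r k = inv h k" for k
  obtain B where B: "\<And>k. k \<in> range h \<Longrightarrow> \<bar>f (r k)\<bar> \<le> B"
    using bdd_above_finite[OF finite_imageI[OF h(1), of "\<lambda>k. \<bar>f (r k)\<bar>"]]
    unfolding bdd_above_def by blast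
  have "\<bar>f t\<bar> \<le> B + 1" for t
  proof -
    have "h t = h (r (h t))" by (simp add: r_def f_inv_into_f)
    then show ?thesis using h(2)[of t "r (h t)" 0] B[of "h t"] by auto
  qed
  then show thesis using that by blast
qed

text \<open>Two shifts with the same pair of codes differ by an almost period of both functions.
  Subtracting from each shift the representative of its code yields common almost periods at bounded
  distance from every real number.\<close>

lemma common_almost_periods:
  assumes "almost_periodic f" "almost_periodic g" "\<epsilon> > 0"
  shows "relatively_dense {T. \<forall>t. \<bar>f (t + T) - f t\<bar> < \<epsilon> \<and> \<bar>g (t + T) - g t\<bar> < \<epsilon>}"
    (is "relatively_dense ?P")
proof -
  obtain h1 :: "real \<Rightarrow> int" where h1: "finite (range h1)"
    "\<And>s s' t. h1 s = h1 s' \<Longrightarrow> \<bar>f (t + s) - f (t + s')\<bar> < \<epsilon>"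
    using almost_periodic_finite_code[OF assms(1,3)] by metis
  obtain h2 :: "real \<Rightarrow> int" where h2: "finite (range h2)"
    "\<And>s s' t. h2 s = h2 s' \<Longrightarrow> \<bar>g (t + s) - g (t + s')\<bar> < \<epsilon>"
    using almost_periodic_finite_code[OF assms(2,3)] by metis
  define h where "h s = (h1 s, h2 s)" for s
  define r where "r k = inv h k" for k
  have "finite (range h)"
    using h1(1) h2(1) by (intro finite_subset[of "range h" "range h1 \<times> range h2"]) (auto simp: h_def)
  then obtain B where B: "\<And>k. k \<in> range h \<Longrightarrow> \<bar>r k\<bar> \<le> B"
    using bdd_above_finite[OF finite_imageI[of "range h" "\<lambda>k. \<bar>r k\<bar>"]]
    unfolding bdd_above_def by blast
  have "B \<ge> 0" using B[of "h 0"] by auto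
  show ?thesis
    unfolding relatively_dense_def
  proof (intro exI[of _ "2 * B + 1"] conjI allI)
    fix x :: real
    \<comment> \<open>Since the representative \<open>s'\<close> lies in \<open>{-B..B}\<close>,
      this offset puts \<open>s - s'\<close> into \<open>{x..x + 2 * B}\<close>; the extra 1 in the
      length keeps it positive when \<open>B = 0\<close>.\<close>
    define s where "s = x + B"
    define s' where "s' = r (h s)"
    have "h s = h s'" by (simp add: s'_def r_def f_inv_into_f)
    then have "\<bar>f (t + s) - f (t + s')\<bar> < \<epsilon>" "\<bar>g (t + s) - g (t + s')\<bar> < \<epsilon>" for t
      using h1(2) h2(2) by (simp_all add: h_def)
    from this[of "t - s'" for t] have "s - s' \<in> ?P"
      by (simp add: algebra_simps)
    moreover have "s - s' \<in> {x..x + (2 * B + 1)}"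
      using B[of "h s"] by (auto simp: s_def s'_def)
    ultimately show "?P \<inter> {x..x + (2 * B + 1)} \<noteq> {}" by blast
  qed (use \<open>B \<ge> 0\<close> in auto)
qed

section \<open>Closure of almost periodicity under sums and constant multiples\<close>

lemma relatively_dense_mono: "relatively_dense S \<Longrightarrow> S \<subseteq> T \<Longrightarrow> relatively_dense T"
  unfolding relatively_dense_def by blast

lemma almost_periodic_const: "almost_periodic (\<lambda>t. k)"
  unfolding almost_periodic_def relatively_dense_def by (auto intro: exI[of _ 1])

lemma almost_periodic_add:
  assumes "almost_periodic f" "almost_periodic g"
  shows "almost_periodic (\<lambda>t. f t + g t)"
  unfolding almost_periodic_def
proof (intro conjI allI impI)
  show "continuous_on UNIV (\<lambda>t. f t + g t)"
    using assms unfolding almost_periodic_def by (intro continuous_intros) auto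
  fix \<epsilon> :: real assume "\<epsilon> > 0"
  then have "relatively_dense {T. \<forall>t. \<bar>f (t + T) - f t\<bar> < \<epsilon> / 2 \<and> \<bar>g (t + T) - g t\<bar> < \<epsilon> / 2}"
    using common_almost_periods[OF assms, of "\<epsilon> / 2"] by simp
  then show "relatively_dense {T. \<forall>t. \<bar>f (t + T) + g (t + T) - (f t + g t)\<bar> < \<epsilon>}"
  proof (rule relatively_dense_mono, safe)
    fix T t assume "\<forall>t. \<bar>f (t + T) - f t\<bar> < \<epsilon> / 2 \<and> \<bar>g (t + T) - g t\<bar> < \<epsilon> / 2"
    then have "\<bar>f (t + T) - f t\<bar> < \<epsilon> / 2" "\<bar>g (t + T) - g t\<bar> < \<epsilon> / 2" by auto
    then show "\<bar>f (t + T) + g (t + T) - (f t + g t)\<bar> < \<epsilon>" by linarith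
  qed
qed

lemma almost_periodic_sum:
  "(\<And>i. i \<in> I \<Longrightarrow> almost_periodic (f i)) \<Longrightarrow> almost_periodic (\<lambda>t. \<Sum>i\<in>I. f i t)"
  by (induction I rule: infinite_finite_induct)
    (simp_all add: almost_periodic_const almost_periodic_add)

lemma almost_periodic_mult_const:
  assumes "almost_periodic f"
  shows "almost_periodic (\<lambda>t. f t * k)"
  unfolding almost_periodic_def
proof (intro conjI allI impI)
  show "continuous_on UNIV (\<lambda>t. f t * k)"
    using assms unfolding almost_periodic_def by (intro continuous_intros) auto
  fix \<epsilon> :: real assume "\<epsilon> > 0"
  \<comment> \<open>Dividing by \<open>\<bar>k\<bar> + 1\<close> also covers
    \<open>k = 0\<close>.\<close>
  then have "relatively_dense {T. \<forall>t. \<bar>f (t + T) - f t\<bar> < \<epsilon> / (\<bar>k\<bar> + 1)}"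
    using assms unfolding almost_periodic_def by simp
  then show "relatively_dense {T. \<forall>t. \<bar>f (t + T) * k - f t * k\<bar> < \<epsilon>}"
  proof (rule relatively_dense_mono, safe)
    fix T t assume "\<forall>t. \<bar>f (t + T) - f t\<bar> < \<epsilon> / (\<bar>k\<bar> + 1)"
    then have "\<bar>f (t + T) - f t\<bar> * (\<bar>k\<bar> + 1) < \<epsilon>"
      by (simp add: pos_less_divide_eq)
    then show "\<bar>f (t + T) * k - f t * k\<bar> < \<epsilon>"
      by (simp flip: left_diff_distrib add: abs_mult distrib_left)
  qed
qed

section \<open>Scalar linear equations\<close>

lemma antiderivative_real:
  fixes f :: "real \<Rightarrow> real"
  assumes "continuous_on UNIV f"
  obtains G where "\<And>t. (G has_real_derivative f t) (at t)"
proof -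
  have "\<exists>G. \<forall>x::real. -\<infinity> < ereal x \<longrightarrow> ereal x < \<infinity> \<longrightarrow> (G has_vector_derivative f x) (at x)"
    using assms by (intro einterval_antiderivative)
      (auto simp: continuous_on_eq_continuous_at)
  then show thesis
    using that by (auto simp: has_real_derivative_iff_has_vector_derivative)
qed

text \<open>With the integrating factor \<open>exp C\<close>, every solution has the form
  \<open>exp (- C t) * (G t - m)\<close>, and the bound \<open>K\<close> means that \<open>m\<close>
  lies between \<open>Q t\<close> and \<open>P t\<close> for all \<open>t\<close>. As
  \<open>c\<close> is only assumed positive, \<open>exp (C t)\<close> may have a positive limit at
  minus infinity; taking \<open>m\<close> as an infimum covers that case too.\<close>

lemma linear_ode_bounded_solution:
  fixes c b :: "real \<Rightarrow> real"
  assumes cont: "continuous_on UNIV c" "continuous_on UNIV b"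
    and c_pos: "\<And>t. 0 < c t" and K: "\<And>t. \<bar>b t\<bar> \<le> K * c t"
  obtains u where "\<And>t. (u has_real_derivative - c t * u t + b t) (at t)" "\<And>t. \<bar>u t\<bar> \<le> K"
proof -
  obtain C where C: "\<And>t. (C has_real_derivative c t) (at t)"
    using antiderivative_real[OF cont(1)] by blast
  have "continuous_on UNIV C"
    using C DERIV_isCont continuous_at_imp_continuous_on by blast
  then have "continuous_on UNIV (\<lambda>t. exp (C t) * b t)"
    by (intro continuous_intros cont)
  then obtain G where G: "\<And>t. (G has_real_derivative exp (C t) * b t) (at t)"
    using antiderivative_real by blast
  \<comment> \<open>\<open>m\<close> is the limit of \<open>G\<close> at \<open>-\<infinity>\<close> if \<open>exp (C t)\<close> vanishes there, so that \<open>G - m\<close> is the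
    integral of \<open>exp (C t) * b t\<close> from \<open>-\<infinity>\<close>.\<close>
  define P where "P t = G t + K * exp (C t)" for t
  define Q where "Q t = G t - K * exp (C t)" for t
  define m where "m = (INF t. P t)"
  have P': "(P has_real_derivative exp (C t) * (b t + K * c t)) (at t)" for t
    unfolding P_def by (auto intro!: derivative_eq_intros G C simp: algebra_simps)
  have Q': "(Q has_real_derivative exp (C t) * (b t - K * c t)) (at t)" for t
    unfolding Q_def by (auto intro!: derivative_eq_intros G C simp: algebra_simps)
  have P_mono: "P s \<le> P t" if "s \<le> t" for s t
  proof (rule DERIV_nonneg_imp_nondecreasing[OF that])
    fix x show "\<exists>y. (P has_real_derivative y) (at x) \<and> 0 \<le> y"
      using P'[of x] K[of x] by (intro exI conjI) (auto simp: abs_le_iff intro!: mult_nonneg_nonneg)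
  qed
  have Q_mono: "Q t \<le> Q s" if "s \<le> t" for s t
  proof (rule DERIV_nonpos_imp_nonincreasing[OF that])
    fix x show "\<exists>y. (Q has_real_derivative y) (at x) \<and> y \<le> 0"
      using Q'[of x] K[of x] by (intro exI conjI) (auto simp: abs_le_iff intro!: mult_nonneg_nonpos)
  qed
  have "0 \<le> K * c 0" using K[of 0] by linarith
  then have "0 \<le> K" using c_pos[of 0] by (simp add: zero_le_mult_iff)
  then have QP: "Q t \<le> P t" for t by (simp add: P_def Q_def add_increasing2)
  \<comment> \<open>Both functions are compared at the earlier of the two times: \<open>P\<close>
    increases from there and \<open>Q\<close> decreases.\<close>
  have QP': "Q t \<le> P s" for s t
    using P_mono[of t s] Q_mono[of s t] QP[of s] QP[of t] by linarith
  have "m \<le> P t" for t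
    unfolding m_def by (rule cINF_lower) (auto intro!: bdd_belowI QP')
  moreover have "Q t \<le> m" for t
    unfolding m_def by (rule cINF_greatest) (auto intro!: QP')
  ultimately have Gm: "\<bar>G t - m\<bar> \<le> K * exp (C t)" for t
    unfolding P_def Q_def abs_le_iff by (simp add: algebra_simps)
  show thesis
  proof (rule that)
    fix t
    show "((\<lambda>t. exp (- C t) * (G t - m)) has_real_derivative
        - c t * (exp (- C t) * (G t - m)) + b t) (at t)"
      by (auto intro!: derivative_eq_intros G C simp: exp_minus field_simps)
    have "\<bar>exp (- C t) * (G t - m)\<bar> \<le> exp (- C t) * (K * exp (C t))"
      using Gm[of t] by (simp add: abs_mult)
    also have "\<dots> = K" by (simp add: exp_minus)
    finally show "\<bar>exp (- C t) * (G t - m)\<bar> \<le> K" .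
  qed
qed

text \<open>The function \<open>(w - K) * exp C\<close> is nonincreasing. An excess
  \<open>d > 0\<close> over \<open>K\<close> at time \<open>t\<close> would thus be at least
  \<open>d * exp (c0 * x)\<close> at time \<open>t - x\<close>, which for large \<open>x\<close>
  contradicts the upper bound \<open>B\<close>.\<close>

lemma linear_ode_bounded_le:
  fixes c r w :: "real \<Rightarrow> real"
  assumes cont: "continuous_on UNIV c" and c0: "c0 > 0" "\<And>t. c0 \<le> c t"
    and w: "\<And>t. (w has_real_derivative - c t * w t + r t) (at t)"
    and B: "\<And>t. w t \<le> B" and K: "\<And>t. r t \<le> K * c t"
  shows "w t \<le> K"
proof (rule ccontr)
  assume "\<not> w t \<le> K"
  define d where "d = w t - K"
  have "d > 0" using \<open>\<not> w t \<le> K\<close> by (simp add: d_def)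
  obtain C where C: "\<And>t. (C has_real_derivative c t) (at t)"
    using antiderivative_real[OF cont] by blast
  define M where "M = B - K"
  have "d \<le> M" using B[of t] by (simp add: d_def M_def)
  \<comment> \<open>Chosen so that the estimate \<open>exp y \<ge> 1 + y\<close> already gives an
    excess of \<open>d * (1 + c0 * x) = d + M\<close>, more than the largest possible excess
    \<open>M\<close>.\<close>
  define x where "x = M / (d * c0)"
  have "x \<ge> 0" using \<open>d > 0\<close> \<open>d \<le> M\<close> c0 by (simp add: x_def)
  have "(w t - K) * exp (C t) \<le> (w (t - x) - K) * exp (C (t - x))"
  proof (rule DERIV_nonpos_imp_nonincreasing[where f = "\<lambda>s. (w s - K) * exp (C s)"])
    fix s
    have "((\<lambda>s. (w s - K) * exp (C s)) has_real_derivative exp (C s) * (r s - K * c s)) (at s)"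
      by (auto intro!: derivative_eq_intros w C simp: algebra_simps)
    then show "\<exists>y. ((\<lambda>s. (w s - K) * exp (C s)) has_real_derivative y) (at s) \<and> y \<le> 0"
      using K[of s] by (intro exI conjI) (auto intro!: mult_nonneg_nonpos)
  qed (use \<open>x \<ge> 0\<close> in auto)
  also have "\<dots> \<le> M * exp (C (t - x))"
    using B[of "t - x"] by (simp add: M_def)
  finally have "d * exp (C t - C (t - x)) \<le> M"
    by (simp add: d_def exp_diff field_simps)
  moreover have "C (t - x) - c0 * (t - x) \<le> C t - c0 * t"
  proof (rule DERIV_nonneg_imp_nondecreasing[where f = "\<lambda>s. C s - c0 * s"])
    fix s
    have "((\<lambda>s. C s - c0 * s) has_real_derivative c s - c0) (at s)"
      by (auto intro!: derivative_eq_intros C)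
    then show "\<exists>y. ((\<lambda>s. C s - c0 * s) has_real_derivative y) (at s) \<and> 0 \<le> y"
      using c0(2)[of s] by (intro exI conjI) auto
  qed (use \<open>x \<ge> 0\<close> in auto)
  then have "1 + c0 * x \<le> exp (C t - C (t - x))"
    using exp_ge_add_one_self[of "C t - C (t - x)"] by (simp add: algebra_simps)
  then have "d * (1 + c0 * x) \<le> d * exp (C t - C (t - x))"
    using \<open>d > 0\<close> by simp
  moreover have "d * (1 + c0 * x) = d + M"
    using \<open>d > 0\<close> c0 by (simp add: x_def field_simps)
  ultimately show False using \<open>d > 0\<close> by linarith
qed

lemma linear_ode_bounded_ge:
  fixes c r w :: "real \<Rightarrow> real"
  assumes "continuous_on UNIV c" "c0 > 0" "\<And>t. c0 \<le> c t"
    and w: "\<And>t. (w has_real_derivative - c t * w t + r t) (at t)"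
    and B: "\<And>t. B \<le> w t" and K: "\<And>t. K * c t \<le> r t"
  shows "K \<le> w t"
proof -
  have "((\<lambda>t. - w t) has_real_derivative - c t * (- w t) + (- r t)) (at t)" for t
    using DERIV_minus[OF w[of t]] by simp
  from linear_ode_bounded_le[where K = "- K" and B = "- B", OF assms(1-3) this]
  have "- w t \<le> - K" using B K by simp
  then show ?thesis by simp
qed

lemma linear_ode_almost_periodic:
  fixes c b u :: "real \<Rightarrow> real"
  assumes ap: "almost_periodic c" "almost_periodic b" and c0: "c0 > 0" "\<And>t. c0 \<le> c t"
    and u: "\<And>t. (u has_real_derivative - c t * u t + b t) (at t)" and B: "\<And>t. \<bar>u t\<bar> \<le> B"
  shows "almost_periodic u"
  unfolding almost_periodic_def
proof (intro conjI allI impI)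
  show "continuous_on UNIV u"
    using u DERIV_isCont continuous_at_imp_continuous_on by blast
  fix \<epsilon> :: real assume "\<epsilon> > 0"
  have "B \<ge> 0" using B[of 0] by linarith
  \<comment> \<open>The change of \<open>c\<close>, multiplied by \<open>u\<close>, contributes at
    most \<open>\<eta> * B\<close> to the forcing of the difference, and the change of
    \<open>b\<close> at most \<open>\<eta>\<close>; together they must stay below
    \<open>\<epsilon> / 2 * c0\<close>.\<close>
  define \<eta> where "\<eta> = \<epsilon> * c0 / (2 * (B + 1))"
  have "\<eta> > 0" using \<open>\<epsilon> > 0\<close> \<open>B \<ge> 0\<close> c0 by (simp add: \<eta>_def)
  have \<eta>: "\<eta> * (B + 1) = \<epsilon> / 2 * c0" using \<open>B \<ge> 0\<close> by (simp add: \<eta>_def field_simps)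
  from common_almost_periods[OF ap \<open>\<eta> > 0\<close>]
  show "relatively_dense {T. \<forall>t. \<bar>u (t + T) - u t\<bar> < \<epsilon>}"
  proof (rule relatively_dense_mono, safe)
    fix T t assume T: "\<forall>t. \<bar>c (t + T) - c t\<bar> < \<eta> \<and> \<bar>b (t + T) - b t\<bar> < \<eta>"
    define w where "w t = u (t + T) - u t" for t
    \<comment> \<open>Replacing \<open>c (t + T)\<close> by \<open>c t\<close> in the translated
      equation costs the first term of \<open>r\<close>, so that \<open>w\<close> solves an equation
      with the original coefficient \<open>c\<close>.\<close>
    define r where "r t = (c t - c (t + T)) * u (t + T) + (b (t + T) - b t)" for t
    have "((\<lambda>t. u (t + T)) has_real_derivative - c (t + T) * u (t + T) + b (t + T)) (at t)" for t
      using u[of "t + T"] by (subst DERIV_shift[symmetric])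
    from DERIV_diff[OF this u]
    have w: "(w has_real_derivative - c t * w t + r t) (at t)" for t
      unfolding w_def r_def by (rule DERIV_cong) (simp add: algebra_simps)
    have wB: "w t \<le> 2 * B" "- (2 * B) \<le> w t" for t
      using B[of t] B[of "t + T"] by (auto simp: w_def)
    have r: "\<bar>r t\<bar> \<le> \<epsilon> / 2 * c t" for t
    proof -
      have T': "\<bar>c t - c (t + T)\<bar> \<le> \<eta>" "\<bar>b (t + T) - b t\<bar> \<le> \<eta>"
        using T[rule_format, of t] by linarith+
      then have "\<bar>(c t - c (t + T)) * u (t + T)\<bar> \<le> \<eta> * B"
        unfolding abs_mult using B[of "t + T"] \<open>\<eta> > 0\<close> by (intro mult_mono) simp_all
      with T'(2) have "\<bar>r t\<bar> \<le> \<eta> * B + \<eta>"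
        unfolding r_def by linarith
      also have "\<dots> = \<epsilon> / 2 * c0" using \<eta> by (simp add: algebra_simps)
      also have "\<dots> \<le> \<epsilon> / 2 * c t" using c0 \<open>\<epsilon> > 0\<close> by simp
      finally show ?thesis .
    qed
    have cc: "continuous_on UNIV c" using ap(1) by (simp add: almost_periodic_def)
    have r': "r t \<le> \<epsilon> / 2 * c t" "- (\<epsilon> / 2) * c t \<le> r t" for t
      using r[of t] by linarith+
    have "w t \<le> \<epsilon> / 2"
      by (rule linear_ode_bounded_le[OF cc c0 w wB(1) r'(1)])
    moreover have "- (\<epsilon> / 2) \<le> w t"
      by (rule linear_ode_bounded_ge[OF cc c0 w wB(2) r'(2)])
    ultimately show "\<bar>u (t + T) - u t\<bar> < \<epsilon>"
      using \<open>\<epsilon> > 0\<close> by (simp add: w_def abs_less_iff)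
  qed
qed

section \<open>The inner bounds\<close>

text \<open>Left of the threshold \<open>g i\<close> is constant, so the equation for the root is
  affine with slope \<open>- (SUP t. c i t)\<close> and is solved by a quotient. \<open>H\<close>
  says that the decreasing left-hand side is already nonpositive at the threshold, so the zero lies
  at or to the left of it.\<close>

lemma ell_hat_root:
  assumes B: "class_B (g i) gt (ell i) (v i)" and "\<sigma> i > 0" and c: "(SUP t. c i t) > 0"
    and H: "- (SUP t. c i t) * (ell i 1 / \<sigma> i) + (INF t. \<Sum>l\<in>UNIV. a i i l t) * v i 1
      + coupling a v i + (SUP t. J i t) \<le> 0"
  shows "ell_hat c a J \<sigma> g ell v i \<le> ell i 1 / \<sigma> i"
    and "(SUP t. c i t) * ell_hat c a J \<sigma> g ell v i =
      (INF t. \<Sum>l\<in>UNIV. a i i l t) * v i 1 + coupling a v i + (SUP t. J i t)"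
proof -
  define R where "R = (INF t. \<Sum>l\<in>UNIV. a i i l t) * v i 1 + coupling a v i + (SUP t. J i t)"
  have F: "F c a \<sigma> g i y = - (SUP t. c i t) * y + (INF t. \<Sum>l\<in>UNIV. a i i l t) * v i 1"
    if "y \<le> ell i 1 / \<sigma> i" for y
    using class_B_left[OF B, of "\<sigma> i * y"] that \<open>\<sigma> i > 0\<close>
    by (simp add: F_def field_simps)
  have le: "R / (SUP t. c i t) \<le> ell i 1 / \<sigma> i"
    using H c by (simp add: pos_divide_le_eq R_def mult.commute)
  have "ell_hat c a J \<sigma> g ell v i = R / (SUP t. c i t)"
    unfolding ell_hat_def
  proof (rule the_equality)
    show "R / (SUP t. c i t) \<le> ell i 1 / \<sigma> i \<and>
        F c a \<sigma> g i (R / (SUP t. c i t)) + coupling a v i + (SUP t. J i t) = 0"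
      using le F[OF le] c by (simp add: R_def)
  next
    fix y assume y: "y \<le> ell i 1 / \<sigma> i \<and> F c a \<sigma> g i y + coupling a v i + (SUP t. J i t) = 0"
    then show "y = R / (SUP t. c i t)"
      using F[of y] c by (simp add: R_def field_simps)
  qed
  with le c show "ell_hat c a J \<sigma> g ell v i \<le> ell i 1 / \<sigma> i"
    and "(SUP t. c i t) * ell_hat c a J \<sigma> g ell v i =
      (INF t. \<Sum>l\<in>UNIV. a i i l t) * v i 1 + coupling a v i + (SUP t. J i t)"
    by (simp_all add: R_def)
qed

lemma ell_tilde_root:
  assumes B: "class_B (g i) gt (ell i) (v i)" and "\<sigma> i > 0" and c: "(SUP t. c i t) > 0"
    and H: "0 \<le> - (SUP t. c i t) * (ell i 2 / \<sigma> i) + (INF t. \<Sum>l\<in>UNIV. a i i l t) * v i 2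
      - coupling a v i + (INF t. J i t)"
  shows "ell i 2 / \<sigma> i \<le> ell_tilde c a J \<sigma> g ell v i"
    and "(SUP t. c i t) * ell_tilde c a J \<sigma> g ell v i =
      (INF t. \<Sum>l\<in>UNIV. a i i l t) * v i 2 - coupling a v i + (INF t. J i t)"
proof -
  define R where "R = (INF t. \<Sum>l\<in>UNIV. a i i l t) * v i 2 - coupling a v i + (INF t. J i t)"
  have F: "F c a \<sigma> g i y = - (SUP t. c i t) * y + (INF t. \<Sum>l\<in>UNIV. a i i l t) * v i 2"
    if "y \<ge> ell i 2 / \<sigma> i" for y
    using class_B_right[OF B, of "\<sigma> i * y"] that \<open>\<sigma> i > 0\<close>
    by (simp add: F_def field_simps)
  have le: "ell i 2 / \<sigma> i \<le> R / (SUP t. c i t)"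
    using H c by (simp add: pos_le_divide_eq R_def mult.commute)
  have "ell_tilde c a J \<sigma> g ell v i = R / (SUP t. c i t)"
    unfolding ell_tilde_def
  proof (rule the_equality)
    show "ell i 2 / \<sigma> i \<le> R / (SUP t. c i t) \<and>
        F c a \<sigma> g i (R / (SUP t. c i t)) - coupling a v i + (INF t. J i t) = 0"
      using le F[OF le] c by (simp add: R_def)
  next
    fix y assume y: "ell i 2 / \<sigma> i \<le> y \<and> F c a \<sigma> g i y - coupling a v i + (INF t. J i t) = 0"
    then show "y = R / (SUP t. c i t)"
      using F[of y] c by (simp add: R_def field_simps)
  qed
  with le c show "ell i 2 / \<sigma> i \<le> ell_tilde c a J \<sigma> g ell v i"
    and "(SUP t. c i t) * ell_tilde c a J \<sigma> g ell v i =
      (INF t. \<Sum>l\<in>UNIV. a i i l t) * v i 2 - coupling a v i + (INF t. J i t)"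
    by (simp_all add: R_def)
qed

theorem theorem6:
  fixes c J :: "'n::finite \<Rightarrow> real \<Rightarrow> real"
    and a \<kappa> :: "'n \<Rightarrow> 'n \<Rightarrow> 'm::finite \<Rightarrow> real \<Rightarrow> real"
    and \<kappa>_max :: "'n \<Rightarrow> 'n \<Rightarrow> 'm \<Rightarrow> real"
    and \<sigma> :: "'n \<Rightarrow> real"
    and g gt :: "'n \<Rightarrow> real \<Rightarrow> real"
    and ell v :: "'n \<Rightarrow> nat \<Rightarrow> real"
    and \<Sigma> :: "'n \<Rightarrow> nat"
  assumes "\<And>i j l t. 0 < \<kappa> i j l t \<and> \<kappa> i j l t \<le> \<kappa>_max i j l"
    and "H1 c a \<kappa> J \<sigma>"
    and "\<And>i. class_B (g i) (gt i) (ell i) (v i)"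
    and "H1B c a \<sigma> gt ell"
    and "H2B c a J \<sigma> ell v"
    and "\<And>i. \<Sigma> i \<in> {1, 2}"
  shows "\<exists>u :: real \<Rightarrow> real ^ 'n.
           almost_periodic_vec u \<and> gnn_solution c a \<kappa> J \<sigma> g u \<and>
           (\<forall>t i. \<alpha> c a J \<sigma> g ell v i (\<Sigma> i) \<le> u t $ i \<and> u t $ i \<le> \<beta> c a J \<sigma> g ell v i (\<Sigma> i))"
proof -

  \<comment> \<open>Bounds on the coefficients\<close>
  have ap: "almost_periodic (c i)" "almost_periodic (a i j l)" "almost_periodic (J i)" for i j l
    using assms(2) by (auto simp: H1_def)
  have pos: "(INF t. c i t) > 0" "a i i l t > 0" "\<sigma> i > 0" "c i t > 0" for i l t
    using assms(2) by (auto simp: H1_def)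
  have bdd: "bdd_above (range f)" "bdd_below (range f)" "bdd_above (range (\<lambda>t. \<bar>f t\<bar>))"
    if "almost_periodic f" for f
  proof -
    obtain B where B: "\<And>t. \<bar>f t\<bar> \<le> B"
      using almost_periodic_bounded[OF \<open>almost_periodic f\<close>] by blast
    have "f t \<le> B" "- B \<le> f t" for t
      using B[of t] by linarith+
    then show "bdd_above (range f)" "bdd_below (range f)"
      by (meson bdd_aboveI2 bdd_belowI2)+
    show "bdd_above (range (\<lambda>t. \<bar>f t\<bar>))"
      using B by (rule bdd_aboveI2)
  qed
  have le_SUP: "f t \<le> (SUP t. f t)" "\<bar>f t\<bar> \<le> (SUP t. \<bar>f t\<bar>)" "(INF t. f t) \<le> f t"
    if "almost_periodic f" for f t
    by (rule cSUP_upper cINF_lower; use bdd[OF that] in simp)+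
  have c_sup: "(SUP t. c i t) > 0" for i
    using pos(1)[of i] le_SUP(1,3)[OF ap(1)[of i], of 0] by linarith
  have diag: "(INF t. \<Sum>l\<in>UNIV. a i i l t) \<le> (\<Sum>l\<in>UNIV. a i i l t)" for i t
    by (intro cINF_lower bdd_belowI2[of _ 0] sum_nonneg less_imp_le[OF pos(2)]) simp
  have v_sign: "v i 1 < 0" "0 < v i 2" and ell_sign: "ell i 1 < 0" "0 < ell i 2" for i
    using assms(3)[of i] by (auto simp: class_B_def)
  have vU: "\<bar>v j (\<Sigma> j)\<bar> \<le> U v j" for j
    using assms(6)[of j] by (auto simp: U_def)

  \<comment> \<open>The decoupled linear equations and their bounded solutions\<close>
  define b where "b i t = (\<Sum>l\<in>UNIV. \<Sum>j\<in>UNIV. a i j l t * v j (\<Sigma> j)) + J i t" for i t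
  \<comment> \<open>\<open>b\<close> is the network input with every activation replaced by the
    saturation level that \<open>\<Sigma>\<close> selects; \<open>off\<close> is the share of the
    other neurons, which \<open>coupling\<close> bounds.\<close>
  define off where "off i t = (\<Sum>l\<in>UNIV. \<Sum>j\<in>UNIV - {i}. a i j l t * v j (\<Sigma> j))" for i t
  have b_ap: "almost_periodic (b i)" for i
    unfolding b_def
    by (intro almost_periodic_add almost_periodic_sum almost_periodic_mult_const ap)
  have entry: "\<bar>a i j l t * v j (\<Sigma> j)\<bar> \<le> (SUP t. \<bar>a i j l t\<bar>) * U v j" for i j l t
    unfolding abs_mult using vU[of j] le_SUP(2)[OF ap(2)[of i j l], of t]
    by (intro mult_mono) auto
  have off: "\<bar>off i t\<bar> \<le> coupling a v i" for i t
    unfolding off_def coupling_def by (intro order.trans[OF sum_abs] sum_mono entry)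
  have b_split: "b i t = (\<Sum>l\<in>UNIV. a i i l t) * v i (\<Sigma> i) + off i t + J i t" for i t
  proof -
    have "(\<Sum>j\<in>UNIV. a i j l t * v j (\<Sigma> j)) =
        a i i l t * v i (\<Sigma> i) + (\<Sum>j\<in>UNIV - {i}. a i j l t * v j (\<Sigma> j))" for l
      by (rule sum.remove) auto
    then show ?thesis by (simp only: b_def off_def sum.distrib sum_distrib_right)
  qed
  have b_outer: "\<bar>b i t\<bar> \<le> outer_bound c a J v i * c i t" for i t
  proof -
    have "\<bar>\<Sum>l\<in>UNIV. \<Sum>j\<in>UNIV. a i j l t * v j (\<Sigma> j)\<bar>
        \<le> (\<Sum>l\<in>UNIV. \<Sum>j\<in>UNIV. (SUP t. \<bar>a i j l t\<bar>) * U v j)"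
      by (intro order.trans[OF sum_abs] sum_mono entry)
    then have "\<bar>b i t\<bar> \<le> outer_bound c a J v i * (INF t. c i t)"
      using le_SUP(2)[OF ap(3)[of i], of t] pos(1)[of i] by (simp add: b_def outer_bound_def)
    \<comment> \<open>The sign allows \<open>INF t. c i t\<close> to be replaced by the larger
      \<open>c i t\<close>.\<close>
    moreover from this have "outer_bound c a J v i \<ge> 0"
      using pos(1)[of i] by (smt (verit) mult_neg_pos)
    ultimately show ?thesis
      using le_SUP(3)[OF ap(1)[of i], of t] by (meson mult_left_mono order_trans)
  qed
  have cont: "continuous_on UNIV (c i)" "continuous_on UNIV (b i)" for i
    using ap(1)[of i] b_ap[of i] by (auto simp: almost_periodic_def)
  have "\<exists>u. (\<forall>t. (u has_real_derivative - c i t * u t + b i t) (at t)) \<and>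
      (\<forall>t. \<bar>u t\<bar> \<le> outer_bound c a J v i)" for i
    by (rule linear_ode_bounded_solution[OF cont[of i] pos(4)[of i] b_outer[of i]]) blast
  then have "\<exists>u. \<forall>i. (\<forall>t. (u i has_real_derivative - c i t * u i t + b i t) (at t)) \<and>
      (\<forall>t. \<bar>u i t\<bar> \<le> outer_bound c a J v i)"
    by (intro choice allI)
  then obtain u where u: "\<And>i t. (u i has_real_derivative - c i t * u i t + b i t) (at t)"
    and u_outer: "\<And>i t. \<bar>u i t\<bar> \<le> outer_bound c a J v i"
    by blast
  have u_le: "u i t \<le> outer_bound c a J v i" and u_ge: "- outer_bound c a J v i \<le> u i t" for i t
    using u_outer[of i t] by auto
  note c_low = pos(1) le_SUP(3)[OF ap(1)]

  \<comment> \<open>Comparison of the solutions with the inner bounds\<close>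
  have hat: "u i t \<le> ell_hat c a J \<sigma> g ell v i" "ell_hat c a J \<sigma> g ell v i \<le> ell i 1 / \<sigma> i"
    if i: "\<Sigma> i = 1" for i t
  proof -
    \<comment> \<open>\<open>H2B\<close> is strict at each time; passing to the supremum of
      \<open>J i\<close> leaves a non-strict inequality, which is the form that
      \<open>ell_hat_root\<close> takes.\<close>
    have "J i t \<le> (SUP t. c i t) * (ell i 1 / \<sigma> i) - (INF t. \<Sum>l\<in>UNIV. a i i l t) * v i 1
        - coupling a v i" for t
      using assms(5)[unfolded H2B_def, rule_format, of 1 i t] by simp
    then have "(SUP t. J i t) \<le> (SUP t. c i t) * (ell i 1 / \<sigma> i)
        - (INF t. \<Sum>l\<in>UNIV. a i i l t) * v i 1 - coupling a v i"
      by (intro cSUP_least) auto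
    then have H: "- (SUP t. c i t) * (ell i 1 / \<sigma> i) + (INF t. \<Sum>l\<in>UNIV. a i i l t) * v i 1
      + coupling a v i + (SUP t. J i t) \<le> 0" by linarith
    note root = ell_hat_root[where i = i and c = c and a = a and J = J and g = g and ell = ell and v = v and \<sigma> = \<sigma>,
      OF assms(3) pos(3) c_sup H]
    show "ell_hat c a J \<sigma> g ell v i \<le> ell i 1 / \<sigma> i" by (rule root(1))
    have neg: "ell_hat c a J \<sigma> g ell v i \<le> 0"
      using root(1) ell_sign(1)[of i] pos(3)[of i] by (smt (verit) divide_neg_pos)
    show "u i t \<le> ell_hat c a J \<sigma> g ell v i"
    proof (rule linear_ode_bounded_le[OF cont(1) c_low u u_le])
      fix t
      \<comment> \<open>Both \<open>v i 1\<close> and \<open>ell_hat\<close> are nonpositive, so the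
        infimum of the diagonal sum and the supremum of \<open>c i\<close> each give the worst case
        from above.\<close>
      have "(\<Sum>l\<in>UNIV. a i i l t) * v i 1 \<le> (INF t. \<Sum>l\<in>UNIV. a i i l t) * v i 1"
        using diag v_sign(1)[of i] by (simp add: mult_right_mono_neg)
      then have "b i t \<le> (SUP t. c i t) * ell_hat c a J \<sigma> g ell v i"
        unfolding root(2) b_split i using off[of i t] le_SUP(1)[OF ap(3)[of i], of t] by linarith
      also have "\<dots> \<le> c i t * ell_hat c a J \<sigma> g ell v i"
        using le_SUP(1)[OF ap(1)[of i], of t] neg by (rule mult_right_mono_neg)
      finally show "b i t \<le> ell_hat c a J \<sigma> g ell v i * c i t" by (simp add: mult.commute)
    qed
  qed
  have tilde: "ell_tilde c a J \<sigma> g ell v i \<le> u i t" "ell i 2 / \<sigma> i \<le> ell_tilde c a J \<sigma> g ell v i"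
    if i: "\<Sigma> i = 2" for i t
  proof -
    have "(SUP t. c i t) * (ell i 2 / \<sigma> i) - (INF t. \<Sum>l\<in>UNIV. a i i l t) * v i 2
        + coupling a v i \<le> J i t" for t
      using assms(5)[unfolded H2B_def, rule_format, of 2 i t] by simp
    then have "(SUP t. c i t) * (ell i 2 / \<sigma> i) - (INF t. \<Sum>l\<in>UNIV. a i i l t) * v i 2
        + coupling a v i \<le> (INF t. J i t)"
      by (intro cINF_greatest) auto
    then have H: "0 \<le> - (SUP t. c i t) * (ell i 2 / \<sigma> i) + (INF t. \<Sum>l\<in>UNIV. a i i l t) * v i 2
      - coupling a v i + (INF t. J i t)" by linarith
    note root = ell_tilde_root[where i = i and c = c and a = a and J = J and g = g and ell = ell and v = v and \<sigma> = \<sigma>,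
      OF assms(3) pos(3) c_sup H]
    show "ell i 2 / \<sigma> i \<le> ell_tilde c a J \<sigma> g ell v i" by (rule root(1))
    have nonneg: "0 \<le> ell_tilde c a J \<sigma> g ell v i"
      using root(1) ell_sign(2)[of i] pos(3)[of i] by (smt (verit) divide_pos_pos)
    show "ell_tilde c a J \<sigma> g ell v i \<le> u i t"
    proof (rule linear_ode_bounded_ge[OF cont(1) c_low u u_ge])
      fix t
      \<comment> \<open>Here \<open>v i 2\<close> and \<open>ell_tilde\<close> are nonnegative, so
        the same two extremal coefficients give the worst case from below.\<close>
      have "ell_tilde c a J \<sigma> g ell v i * c i t \<le> (SUP t. c i t) * ell_tilde c a J \<sigma> g ell v i"
        using le_SUP(1)[OF ap(1)[of i], of t] nonneg
        by (subst mult.commute) (rule mult_right_mono)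
      moreover have "(INF t. \<Sum>l\<in>UNIV. a i i l t) * v i 2 \<le> (\<Sum>l\<in>UNIV. a i i l t) * v i 2"
        using diag v_sign(2)[of i] by (simp add: mult_right_mono)
      then have "(SUP t. c i t) * ell_tilde c a J \<sigma> g ell v i \<le> b i t"
        unfolding root(2) b_split i using off[of i t] le_SUP(3)[OF ap(3)[of i], of t] by linarith
      ultimately show "ell_tilde c a J \<sigma> g ell v i * c i t \<le> b i t" by linarith
    qed
  qed

  \<comment> \<open>Return from the decoupled equations to the network\<close>
  have saturated: "g j (\<sigma> j * u j t) = v j (\<Sigma> j)" for j t
  proof (cases "\<Sigma> j = 1")
    case True
    have "u j t \<le> ell j 1 / \<sigma> j"
      using hat(1)[OF True, of t] hat(2)[OF True] by linarith
    then have "\<sigma> j * u j t \<le> ell j 1"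
      using pos(3)[of j] by (simp add: pos_le_divide_eq mult.commute)
    then show ?thesis using class_B_left[OF assms(3)] True by simp
  next
    case False
    have 2: "\<Sigma> j = 2" using assms(6)[of j] False by simp
    have "ell j 2 / \<sigma> j \<le> u j t"
      using tilde(1)[OF 2, of t] tilde(2)[OF 2] by linarith
    then have "ell j 2 \<le> \<sigma> j * u j t"
      using pos(3)[of j] by (simp add: pos_divide_le_eq mult.commute)
    then show ?thesis using class_B_right[OF assms(3)] 2 by simp
  qed
  have "almost_periodic_vec (\<lambda>t. \<chi> i. u i t)"
    unfolding almost_periodic_vec_def vec_lambda_beta
    using linear_ode_almost_periodic[OF ap(1) b_ap c_low u u_outer] by blast
  moreover have "gnn_solution c a \<kappa> J \<sigma> g (\<lambda>t. \<chi> i. u i t)"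
    \<comment> \<open>\<open>saturated\<close> holds at every time, hence also at
      \<open>t - \<kappa> i j l t\<close>; each delayed activation becomes a constant and the
      right-hand side turns into that of the decoupled equation.\<close>
    unfolding gnn_solution_def vec_lambda_beta saturated
    using u by (simp only: b_def add.assoc) blast
  moreover have "\<alpha> c a J \<sigma> g ell v i (\<Sigma> i) \<le> u i t \<and> u i t \<le> \<beta> c a J \<sigma> g ell v i (\<Sigma> i)" for i t
    using assms(6)[of i] hat(1)[of i t] tilde(1)[of i t] u_le[of i t] u_ge[of i t]
    by (auto simp: \<alpha>_def \<beta>_def)
  ultimately show ?thesis
    by (intro exI[of _ "\<lambda>t. \<chi> i. u i t"]) simp
qed

end
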